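(* For every $c>0$ there exists an analytic polynomial $F$ on the unit bi-disc such that \[ \left\|\left(z_1\frac{\partial}{\partial z_1}\right)^2F\right\|_{A(D^2)}\leq 1 \quad\text{and}\quad \left\|\left(z_2\frac{\partial}{\partial z_2}\right)^2F\right\|_{A(D^2)}\leq 1 \] but \[ \left\|z_2\frac{\partial}{\partial z_2}\left(z_1\frac{\partial}{\partial z_1}\right)F\right\|_{A(D^2)}\geq c . \]
   Context: $D^2=\{(z_1,z_2)\in\mathbb{C}^2: |z_1|<1,\ |z_2|<1\}$ is the unit bi-disc. An analytic polynomial is a polynomial in the two complex variables $z_1,z_2$ with complex coefficients. $\|G\|_{A(D^2)}=\sup_{z\in D^2}|G(z)|$ is the supremum norm. $\left(z_j\frac{\partial}{\partial z_j}\right)^2$ denotes the operator $z_j\frac{\partial}{\partial z_j}$ applied twice. *)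

theory Defs
  imports "HOL-Analysis.Analysis"
begin

definition bidisc :: "(complex \<times> complex) set" where
  "bidisc = {(z1, z2). norm z1 < 1 \<and> norm z2 < 1}"

definition analytic_polynomial :: "(complex \<times> complex \<Rightarrow> complex) \<Rightarrow> bool" where
  "analytic_polynomial F \<longleftrightarrow>
     (\<exists>(N::nat) (a :: nat \<Rightarrow> nat \<Rightarrow> complex).
        \<forall>z1 z2. F (z1, z2) = (\<Sum>i\<le>N. \<Sum>j\<le>N. a i j * z1 ^ i * z2 ^ j))"

definition euler_op1 :: "(complex \<times> complex \<Rightarrow> complex) \<Rightarrow> complex \<times> complex \<Rightarrow> complex" where
  "euler_op1 F = (\<lambda>(z1, z2). z1 * deriv (\<lambda>w. F (w, z2)) z1)"

definition euler_op2 :: "(complex \<times> complex \<Rightarrow> complex) \<Rightarrow> complex \<times> complex \<Rightarrow> complex" where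
  "euler_op2 F = (\<lambda>(z1, z2). z2 * deriv (\<lambda>w. F (z1, w)) z2)"

text \<open>The supremum is taken in the reals, so it is the sup norm only for functions bounded
  on the bidisc. Polynomials, and their images under the two operators above (again
  polynomials), are bounded there.\<close>

definition bidisc_norm :: "(complex \<times> complex \<Rightarrow> complex) \<Rightarrow> real" where
  "bidisc_norm G = (SUP z\<in>bidisc. norm (G z))"

end

theory Submission
  imports Defs
begin

text \<open>
  For \<open>n = 2\<^sup>k\<close> let \<open>R\<close> be the sum of three blocks of length \<open>2n + 1\<close> of consecutive powers of
  \<open>z\<^sub>2\<close>, centred at \<open>n\<close>, \<open>2n\<close>, \<open>3n\<close> and weighted by \<open>5\<close>, \<open>-8\<close>, \<open>3\<close>. The weights annihilate the
  moments of order \<open>0\<close> and \<open>2\<close> but not the one of order \<open>1\<close>. Summation by parts away from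
  \<open>z\<^sub>2 = 1\<close>, and the vanishing moments near \<open>z\<^sub>2 = 1\<close>, show that \<open>R / n\<close> and \<open>D\<^sup>2 R / n\<^sup>3\<close>
  (with \<open>D\<close> the Euler operator in \<open>z\<^sub>2\<close>) are at most a constant times
  \<open>min (n d) (1 / (n d))\<close>, where \<open>d = \<bar>1 - z\<^sub>2\<bar>\<close>. The sum of these bounds over all \<open>k\<close> is
  finite, uniformly in \<open>d\<close>. Hence the sum of \<open>z\<^sub>1\<^sup>n R(z\<^sub>2) / n\<^sup>3\<close> over \<open>k < M\<close> has bounded pure
  second derivatives, whereas every \<open>k\<close> contributes at least \<open>4\<close> in absolute value, with the
  same sign, to the mixed derivative at \<open>(1, 1)\<close>.
\<close>

section \<open>Bivariate polynomials\<close>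

text \<open>Exponent pairs may repeat, since overlapping blocks produce the same monomial several
  times; grouping the terms with equal pairs gives the coefficient matrix.\<close>

lemma analytic_polynomial_sum:
  fixes a :: "'t \<Rightarrow> complex" and e1 e2 :: "'t \<Rightarrow> nat"
  assumes "finite T"
  shows "analytic_polynomial (\<lambda>(z1, z2). \<Sum>t\<in>T. a t * z1 ^ e1 t * z2 ^ e2 t)"
proof -
  define N where "N = Max (insert 0 (e1 ` T \<union> e2 ` T))"
  define A where "A i j = (\<Sum>t | t \<in> T \<and> (e1 t, e2 t) = (i, j). a t)" for i j
  have sub: "(\<lambda>t. (e1 t, e2 t)) ` T \<subseteq> {..N} \<times> {..N}"
    using assms by (auto simp: N_def intro!: Max_ge)
  have "(\<Sum>t\<in>T. a t * z1 ^ e1 t * z2 ^ e2 t) = (\<Sum>i\<le>N. \<Sum>j\<le>N. A i j * z1 ^ i * z2 ^ j)" for z1 z2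
  proof -
    have "(\<Sum>t\<in>T. a t * z1 ^ e1 t * z2 ^ e2 t) =
        (\<Sum>p\<in>{..N} \<times> {..N}. \<Sum>t | t \<in> T \<and> (e1 t, e2 t) = p. a t * z1 ^ e1 t * z2 ^ e2 t)"
      by (rule sum.group[symmetric]) (use assms sub in auto)
    also have "\<dots> = (\<Sum>(i, j)\<in>{..N} \<times> {..N}. A i j * z1 ^ i * z2 ^ j)"
      by (intro sum.cong refl) (auto simp: A_def sum_distrib_right intro!: sum.cong)
    finally show ?thesis
      by (simp add: sum.cartesian_product)
  qed
  then show ?thesis
    unfolding analytic_polynomial_def by auto
qed

lemma euler_op1_sum:
  fixes a :: "'t \<Rightarrow> complex" and e1 e2 :: "'t \<Rightarrow> nat"
  shows "euler_op1 (\<lambda>(z1, z2). \<Sum>t\<in>T. a t * z1 ^ e1 t * z2 ^ e2 t) =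
    (\<lambda>(z1, z2). \<Sum>t\<in>T. (of_nat (e1 t) * a t) * z1 ^ e1 t * z2 ^ e2 t)"
proof -
  have "((\<lambda>w. \<Sum>t\<in>T. a t * w ^ e1 t * z2 ^ e2 t) has_field_derivative
      (\<Sum>t\<in>T. a t * (of_nat (e1 t) * z1 ^ (e1 t - 1)) * z2 ^ e2 t)) (at z1)" for z1 z2
    by (auto intro!: derivative_eq_intros sum.cong)
  then have d: "deriv (\<lambda>w. \<Sum>t\<in>T. a t * w ^ e1 t * z2 ^ e2 t) z1 =
      (\<Sum>t\<in>T. a t * (of_nat (e1 t) * z1 ^ (e1 t - 1)) * z2 ^ e2 t)" for z1 z2
    by (rule DERIV_imp_deriv)
  \<comment> \<open>At exponent 0 the truncated \<open>0 - 1 = 0\<close> is harmless, because the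
    factor \<open>of_nat 0\<close> kills the term.\<close>
  have "z * (a t * (of_nat (e1 t) * z ^ (e1 t - 1)) * w) = (of_nat (e1 t) * a t) * z ^ e1 t * w"
    for z w t
    by (cases "e1 t") (auto simp: algebra_simps)
  then show ?thesis
    by (simp only: euler_op1_def prod.case d sum_distrib_left)
qed

lemma euler_op2_sum:
  fixes a :: "'t \<Rightarrow> complex" and e1 e2 :: "'t \<Rightarrow> nat"
  shows "euler_op2 (\<lambda>(z1, z2). \<Sum>t\<in>T. a t * z1 ^ e1 t * z2 ^ e2 t) =
    (\<lambda>(z1, z2). \<Sum>t\<in>T. (of_nat (e2 t) * a t) * z1 ^ e1 t * z2 ^ e2 t)"
proof -
  have "((\<lambda>w. \<Sum>t\<in>T. a t * z1 ^ e1 t * w ^ e2 t) has_field_derivative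
      (\<Sum>t\<in>T. a t * z1 ^ e1 t * (of_nat (e2 t) * z2 ^ (e2 t - 1)))) (at z2)" for z1 z2
    by (auto intro!: derivative_eq_intros sum.cong)
  then have d: "deriv (\<lambda>w. \<Sum>t\<in>T. a t * z1 ^ e1 t * w ^ e2 t) z2 =
      (\<Sum>t\<in>T. a t * z1 ^ e1 t * (of_nat (e2 t) * z2 ^ (e2 t - 1)))" for z1 z2
    by (rule DERIV_imp_deriv)
  have "z * (a t * w * (of_nat (e2 t) * z ^ (e2 t - 1))) = (of_nat (e2 t) * a t) * w * z ^ e2 t"
    for z w t
    by (cases "e2 t") (auto simp: algebra_simps)
  then show ?thesis
    by (simp only: euler_op2_def prod.case d sum_distrib_left)
qed

lemma bidisc_norm_le:
  assumes "\<And>z1 z2. norm z1 \<le> 1 \<Longrightarrow> norm z2 \<le> 1 \<Longrightarrow> norm (G (z1, z2)) \<le> B"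
  shows "bidisc_norm G \<le> B"
  unfolding bidisc_norm_def
proof (rule cSUP_least)
  have "(0, 0) \<in> bidisc"
    by (simp add: bidisc_def)
  then show "bidisc \<noteq> {}"
    by blast
qed (use assms in \<open>auto simp: bidisc_def\<close>)

text \<open>The point \<open>(1, 1)\<close> lies on the boundary, outside \<open>bidisc\<close>, so
  its value is reached as a limit along the diagonal. Compactness of the closed bidisc makes the
  real supremum a genuine upper bound.\<close>

lemma norm_at_one_le_bidisc_norm:
  assumes cont: "continuous_on (cball 0 1 \<times> cball 0 1) G"
  shows "norm (G (1, 1)) \<le> bidisc_norm G"
proof -
  let ?K = "cball (0::complex) 1 \<times> cball (0::complex) 1"
  have "compact ((\<lambda>z. norm (G z)) ` ?K)"
    by (intro compact_continuous_image continuous_intros cont compact_Times compact_cball)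
  then have "bdd_above ((\<lambda>z. norm (G z)) ` ?K)"
    by (intro bounded_imp_bdd_above compact_imp_bounded)
  then have bdd: "bdd_above ((\<lambda>z. norm (G z)) ` bidisc)"
    by (rule bdd_above_mono) (auto simp: bidisc_def)
  have le: "norm (G z) \<le> bidisc_norm G" if "z \<in> bidisc" for z
    unfolding bidisc_norm_def using bdd that by (rule cSUP_upper2) simp
  define r :: "nat \<Rightarrow> complex" where "r m = of_real (1 - inverse (real (Suc m)))" for m
  have "(\<lambda>m. 1 - inverse (real (Suc m))) \<longlonglongrightarrow> 1 - 0"
    by (intro tendsto_intros LIMSEQ_inverse_real_of_nat)
  then have r_lim: "r \<longlonglongrightarrow> 1"
    unfolding r_def by (metis diff_zero of_real_1 tendsto_of_real)
  have r_lt: "norm (r m) < 1" for m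
    unfolding r_def norm_of_real by (auto simp: field_simps)
  have "(\<lambda>m. norm (G (r m, r m))) \<longlonglongrightarrow> norm (G (1, 1))"
  proof (intro tendsto_norm continuous_on_tendsto_compose[OF cont])
    show "(\<lambda>m. (r m, r m)) \<longlonglongrightarrow> (1, 1)"
      by (intro tendsto_Pair r_lim)
  qed (use r_lt in \<open>auto intro!: always_eventually less_imp_le\<close>)
  then show ?thesis
    by (rule LIMSEQ_le_const2) (auto simp: bidisc_def r_lt intro!: exI[of _ 0] le)
qed

section \<open>Block polynomials\<close>

lemma norm_one_minus_power_le:
  fixes z :: "'a::real_normed_field"
  assumes "norm z \<le> 1"
  shows "norm (1 - z ^ m) \<le> real m * norm (1 - z)"
proof -
  have "norm (1 ^ m - z ^ m) \<le> real m * norm (1 - z)"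
    by (rule norm_power_diff) (use assms in auto)
  then show ?thesis
    by simp
qed

text \<open>Abel summation: the factor \<open>1 - z\<close> turns the coefficients into nonnegative
  increments, which telescope to \<open>a L - a 0\<close>; the end terms add
  \<open>a 0 + a L\<close>. The shift by \<open>s\<close> only costs a factor of norm at most
  1.\<close>

lemma norm_sum_mono_coeff_le:
  fixes a :: "nat \<Rightarrow> real" and z :: complex
  assumes "norm z \<le> 1" and "mono a" and "\<And>j. a j \<ge> 0"
  shows "norm (1 - z) * norm (\<Sum>j\<le>L. of_real (a j) * z ^ (j + s)) \<le> 2 * a L"
proof -
  have parts: "(1 - z) * (\<Sum>j\<le>L. of_real (a j) * z ^ j) =
      of_real (a 0) + (\<Sum>j<L. of_real (a (Suc j) - a j) * z ^ Suc j) - of_real (a L) * z ^ Suc L"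
    by (induction L) (auto simp: algebra_simps)
  have pw: "norm (of_real b * z ^ m) \<le> b" if "b \<ge> 0" for b m
    using that assms(1) by (simp add: norm_mult norm_power power_le_one mult_left_le)
  have "norm (\<Sum>j<L. of_real (a (Suc j) - a j) * z ^ Suc j) \<le> (\<Sum>j<L. a (Suc j) - a j)"
    by (intro sum_norm_le pw) (use assms(2) in \<open>auto simp: mono_def\<close>)
  also have "\<dots> = a L - a 0"
    by (rule sum_lessThan_telescope)
  finally have mid: "norm (\<Sum>j<L. of_real (a (Suc j) - a j) * z ^ Suc j) \<le> a L - a 0" .
  have "norm ((1 - z) * (\<Sum>j\<le>L. of_real (a j) * z ^ j)) \<le> a 0 + (a L - a 0) + a L"
    unfolding parts
    by (intro norm_triangle_le_diff norm_triangle_le add_mono mid pw assms(3)) (simp add: assms(3))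
  moreover have "norm ((1 - z) * (\<Sum>j\<le>L. of_real (a j) * z ^ (j + s))) \<le>
      norm ((1 - z) * (\<Sum>j\<le>L. of_real (a j) * z ^ j))"
  proof -
    have "(1 - z) * (\<Sum>j\<le>L. of_real (a j) * z ^ (j + s)) =
        ((1 - z) * (\<Sum>j\<le>L. of_real (a j) * z ^ j)) * z ^ s"
      by (simp add: power_add sum_distrib_left sum_distrib_right mult.assoc)
    then show ?thesis
      using assms(1)
      by (simp only: norm_mult[of _ "z ^ s"]) (simp add: norm_power power_le_one mult_left_le)
  qed
  ultimately show ?thesis
    by (simp add: norm_mult)
qed

text \<open>Block \<open>b\<close> is centred at \<open>(b + 1) * n\<close>, so the weights solve
  \<open>5 - 8 + 3 = 0\<close> and \<open>5 * 1 - 8 * 4 + 3 * 9 = 0\<close>, which fixes them up to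
  scaling; the first moment is proportional to \<open>5 * 1 - 8 * 2 + 3 * 3 = -2\<close>.\<close>

definition block_weight :: "nat \<Rightarrow> real" where
  "block_weight b = (if b = 0 then 5 else if b = 1 then -8 else 3)"

text \<open>This is the \<open>p\<close>-th Euler derivative of \<open>blocks 0 n\<close>; for
  \<open>p = 0\<close> the constant term survives because \<open>0 ^ 0 = 1\<close>.\<close>

definition blocks :: "nat \<Rightarrow> nat \<Rightarrow> complex \<Rightarrow> complex" where
  "blocks p n z =
    (\<Sum>b<3. of_real (block_weight b) * (\<Sum>j\<le>2 * n. of_nat ((j + b * n) ^ p) * z ^ (j + b * n)))"

lemma sum_block_weight:
  fixes f :: "nat \<Rightarrow> 'a::real_algebra_1"
  shows "(\<Sum>b<3. of_real (block_weight b) * f b) = 5 * f 0 - 8 * f 1 + 3 * f 2"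
  by (simp add: block_weight_def eval_nat_numeral)

text \<open>The constant is \<open>5 + 8 + 3\<close>. A free \<open>g\<close> lets the bound serve
  both \<open>z ^ m\<close> and \<open>1 - z ^ m\<close>.\<close>

lemma norm_blocks_le:
  assumes "\<And>b. b < 3 \<Longrightarrow>
    norm (\<Sum>j\<le>2 * n. of_nat ((j + b * n) ^ p) * (g (j + b * n) :: complex)) \<le> C"
  shows "norm (\<Sum>b<3. of_real (block_weight b) *
    (\<Sum>j\<le>2 * n. of_nat ((j + b * n) ^ p) * g (j + b * n))) \<le> 16 * C"
proof -
  have "norm (\<Sum>b<3. of_real (block_weight b) *
      (\<Sum>j\<le>2 * n. of_nat ((j + b * n) ^ p) * g (j + b * n))) \<le> (\<Sum>b<3. \<bar>block_weight b\<bar> * C)"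
    by (intro sum_norm_le, unfold norm_mult norm_of_real, intro mult_left_mono assms) auto
  also have "\<dots> = 16 * C"
    by (simp add: block_weight_def numeral_3_eq_3)
  finally show ?thesis .
qed

text \<open>Abel summation in each block, whose coefficients increase to at most
  \<open>(4 * n) ^ p\<close>; the constant is \<open>32 = 16 * 2\<close>.\<close>

lemma norm_blocks_far:
  assumes "norm z \<le> 1"
  shows "norm (1 - z) * norm (blocks p n z) \<le> 32 * 4 ^ p * real n ^ p"
proof (cases "z = 1")
  case False
  then have pos: "norm (1 - z) > 0"
    by simp
  have "norm (\<Sum>j\<le>2 * n. of_nat ((j + b * n) ^ p) * z ^ (j + b * n))
      \<le> 2 * (4 * real n) ^ p / norm (1 - z)" if "b < 3" for b
  proof -
    have "norm (1 - z) * norm (\<Sum>j\<le>2 * n. of_real (real ((j + b * n) ^ p)) * z ^ (j + b * n))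
        \<le> 2 * real ((2 * n + b * n) ^ p)"
      by (rule norm_sum_mono_coeff_le) (use assms in \<open>auto simp: mono_def intro!: power_mono\<close>)
    moreover have "2 * n + b * n \<le> 4 * n"
      using that mult_le_mono1[of b 2 n] by linarith
    then have "(2 * n + b * n) ^ p \<le> (4 * n) ^ p"
      by (rule power_mono) simp
    then have "real ((2 * n + b * n) ^ p) \<le> real ((4 * n) ^ p)"
      by (rule of_nat_mono)
    ultimately have "norm (1 - z) * norm (\<Sum>j\<le>2 * n. of_nat ((j + b * n) ^ p) * z ^ (j + b * n))
        \<le> 2 * (4 * real n) ^ p"
      by simp
    then show ?thesis
      using pos by (simp add: pos_le_divide_eq mult.commute)
  qed
  then have "norm (blocks p n z) \<le> 16 * (2 * (4 * real n) ^ p / norm (1 - z))"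
    unfolding blocks_def by (rule norm_blocks_le)
  then show ?thesis
    using pos by (simp add: field_simps power_mult_distrib)
qed simp

text \<open>Subtracting the vanishing value at 1 replaces each \<open>z ^ m\<close> by
  \<open>1 - z ^ m\<close>, of norm at most \<open>m * norm (1 - z)\<close> with
  \<open>m \<le> 4 * n\<close>. The constant is \<open>192 = 16 * 3 * 4\<close>, the 3 from
  \<open>2 * n + 1 \<le> 3 * n\<close>.\<close>

lemma norm_blocks_near:
  assumes "norm z \<le> 1" and "blocks p n 1 = 0" and "n > 0"
  shows "norm (blocks p n z) \<le> 192 * 4 ^ p * real n ^ (p + 2) * norm (1 - z)"
proof -
  define d where "d = norm (1 - z)"
  have "norm (\<Sum>j\<le>2 * n. of_nat ((j + b * n) ^ p) * (1 - z ^ (j + b * n)))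
      \<le> real (2 * n + 1) * ((4 * real n) ^ p * (4 * real n * d))" if "b < 3" for b
  proof -
    have "norm (of_nat ((j + b * n) ^ p) * (1 - z ^ (j + b * n)))
        \<le> (4 * real n) ^ p * (4 * real n * d)" if "j \<le> 2 * n" for j
    proof -
      have "j + b * n \<le> 4 * n"
        using that \<open>b < 3\<close> mult_le_mono1[of b 2 n] by linarith
      then have le: "real (j + b * n) \<le> 4 * real n"
        by linarith
      have "norm (1 - z ^ (j + b * n)) \<le> real (j + b * n) * d"
        unfolding d_def by (rule norm_one_minus_power_le[OF assms(1)])
      also have "\<dots> \<le> 4 * real n * d"
        using le by (rule mult_right_mono) (simp add: d_def)
      finally have "norm (1 - z ^ (j + b * n)) \<le> 4 * real n * d" .
      moreover have "real (j + b * n) ^ p \<le> (4 * real n) ^ p"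
        using le by (rule power_mono) simp
      ultimately have "real (j + b * n) ^ p * norm (1 - z ^ (j + b * n))
          \<le> (4 * real n) ^ p * (4 * real n * d)"
        by (intro mult_mono) auto
      then show ?thesis
        by (simp only: norm_mult norm_power norm_of_nat of_nat_power)
    qed
    then have "norm (\<Sum>j\<le>2 * n. of_nat ((j + b * n) ^ p) * (1 - z ^ (j + b * n)))
      \<le> (\<Sum>j\<le>2 * n. (4 * real n) ^ p * (4 * real n * d))"
      by (intro sum_norm_le) auto
    then show ?thesis
      by simp
  qed
  then have "norm (\<Sum>b<3. of_real (block_weight b) *
      (\<Sum>j\<le>2 * n. of_nat ((j + b * n) ^ p) * (1 - z ^ (j + b * n))))
      \<le> 16 * (real (2 * n + 1) * ((4 * real n) ^ p * (4 * real n * d)))"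
    by (rule norm_blocks_le)
  also have "(\<Sum>b<3. of_real (block_weight b) *
      (\<Sum>j\<le>2 * n. of_nat ((j + b * n) ^ p) * (1 - z ^ (j + b * n)))) = blocks p n 1 - blocks p n z"
    unfolding blocks_def by (simp add: sum_subtractf right_diff_distrib)
  finally have "norm (blocks p n z) \<le> 16 * (real (2 * n + 1) * ((4 * real n) ^ p * (4 * real n * d)))"
    using assms(2) by simp
  also have "\<dots> \<le> 16 * ((3 * real n) * ((4 * real n) ^ p * (4 * real n * d)))"
    using assms(3) by (intro mult_left_mono mult_right_mono) (auto simp: d_def)
  also have "\<dots> = 192 * 4 ^ p * real n ^ (p + 2) * d"
    by (simp add: power_mult_distrib power2_eq_square power_add)
  finally show ?thesis
    by (simp add: d_def)
qed

lemma blocks_one: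
  "blocks p n 1 = (\<Sum>j\<le>2 * n. 5 * of_nat j ^ p - 8 * (of_nat j + of_nat n) ^ p
    + 3 * (of_nat j + 2 * of_nat n) ^ p)"
  unfolding blocks_def sum_block_weight
  by (simp add: sum.distrib sum_subtractf sum_distrib_left)

lemma blocks_0_one: "blocks 0 n 1 = 0"
  by (simp add: blocks_one)

text \<open>Every \<open>j\<close> contributes the same \<open>-2 * n\<close>; this surviving moment
  drives the mixed derivative.\<close>

lemma blocks_1_one: "blocks 1 n 1 = - (2 * of_nat n * (2 * of_nat n + 1))"
  by (simp add: blocks_one algebra_simps)

lemma blocks_2_one: "blocks 2 n 1 = 0"
proof -
  \<comment> \<open>The \<open>j\<close>-squared terms cancel, and what remains is antisymmetric
    about the midpoint \<open>j = n\<close>.\<close>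
  have "blocks 2 n 1 = (\<Sum>j\<le>2 * n. 4 * of_nat n * (of_nat n - of_nat j))"
    unfolding blocks_one by (intro sum.cong refl) (simp add: power2_eq_square algebra_simps)
  also have "\<dots> = 4 * of_nat n * ((2 * of_nat n + 1) * of_nat n - (\<Sum>j\<le>2 * n. of_nat j))"
    by (simp add: sum_distrib_left[symmetric] sum_subtractf)
  also have "(\<Sum>j\<le>2 * n. of_nat j) = (2 * of_nat n + 1) * (of_nat n :: complex)"
  proof -
    have "2 * (\<Sum>j\<le>m. of_nat j) = (of_nat m * (of_nat m + 1) :: complex)" for m
      by (induction m) (auto simp: algebra_simps)
    from this[of "2 * n"] have
      "2 * (\<Sum>j\<le>2 * n. of_nat j) = 2 * ((2 * of_nat n + 1) * (of_nat n :: complex))"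
      by simp
    then show ?thesis
      by (simp only: mult_cancel_left) simp
  qed
  finally show ?thesis
    by simp
qed

section \<open>Summation over dyadic scales\<close>

text \<open>With \<open>g t = t / (1 + t)\<close>, the difference \<open>g (2 t) - g t\<close> equals \<open>t / ((1 + t) (1 + 2 t))\<close>,
  which is at least \<open>min t (1 / t) / 6\<close>; summed over \<open>t = 2\<^sup>k d\<close> it telescopes.\<close>

lemma dyadic_sum_le:
  fixes f :: "nat \<Rightarrow> real" and d C :: real
  assumes "d \<ge> 0" and "C \<ge> 0"
    and near: "\<And>k. f k \<le> C * (2 ^ k * d)"
    and far: "\<And>k. f k * (2 ^ k * d) \<le> C"
  shows "(\<Sum>k<M. f k) \<le> 6 * C"
proof -
  define g :: "real \<Rightarrow> real" where "g t = t / (1 + t)" for t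
  have step: "f k \<le> 6 * C * (g (2 ^ Suc k * d) - g (2 ^ k * d))" for k
  proof -
    define t where "t = 2 ^ k * d"
    have t: "t \<ge> 0"
      using assms(1) by (simp add: t_def)
    have diff: "g (2 * t) - g t = t / ((1 + t) * (1 + 2 * t))"
      using t by (simp add: g_def divide_simps) (simp add: algebra_simps)
    define u where "u = t / ((1 + t) * (1 + 2 * t))"
    have "f k \<le> 6 * C * u"
    proof (cases "t \<le> 1")
      case True
      have "(1 + t) * (1 + 2 * t) \<le> 2 * 3"
        using True t by (intro mult_mono) auto
      then have "t / 6 \<le> t / ((1 + t) * (1 + 2 * t))"
        using t by (intro divide_left_mono) auto
      then have "C * (t / 6) \<le> C * u"
        unfolding u_def using assms(2) by (rule mult_left_mono)
      then show ?thesis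
        using near[of k] unfolding t_def[symmetric] by simp
    next
      case False
      then have t1: "t > 1"
        by simp
      have "(1 + t) * (1 + 2 * t) \<le> (2 * t) * (3 * t)"
        using t1 by (intro mult_mono) auto
      then have "t / ((2 * t) * (3 * t)) \<le> t / ((1 + t) * (1 + 2 * t))"
        using t1 by (intro divide_left_mono) auto
      then have "C * (t / ((2 * t) * (3 * t))) \<le> C * u"
        unfolding u_def using assms(2) by (rule mult_left_mono)
      moreover have "f k \<le> C / t"
        using far[of k] t1 by (simp add: t_def[symmetric] pos_le_divide_eq)
      moreover have "6 * (C * (t / ((2 * t) * (3 * t)))) = C / t"
        using t1 by simp
      ultimately show ?thesis
        by simp
    qed
    then show ?thesis
      using diff by (simp add: t_def u_def mult.assoc)
  qed
  have "(\<Sum>k<M. f k) \<le> (\<Sum>k<M. 6 * C * (g (2 ^ Suc k * d) - g (2 ^ k * d)))"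
    by (intro sum_mono step)
  also have "\<dots> = 6 * C * (g (2 ^ M * d) - g (2 ^ 0 * d))"
    unfolding sum_distrib_left[symmetric] by (subst sum_lessThan_telescope) simp
  also have "\<dots> \<le> 6 * C * 1"
  proof (intro mult_left_mono)
    have "g (2 ^ M * d) \<le> 1" "g (2 ^ 0 * d) \<ge> 0"
      using assms(1) by (auto simp: g_def divide_le_eq_1 add_pos_nonneg)
    then show "g (2 ^ M * d) - g (2 ^ 0 * d) \<le> 1"
      by linarith
  qed (use assms(2) in simp)
  finally show ?thesis
    by simp
qed

text \<open>Dividing by \<open>n ^ (p + 1)\<close> scales the near and far bounds to multiples of
  \<open>n * d\<close> and \<open>1 / (n * d)\<close>. As \<open>4 ^ p \<le> 16\<close>, both
  constants are at most \<open>192 * 16 = 3072\<close>, and \<open>18432 = 6 * 3072\<close>.\<close>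

lemma norm_sum_blocks_le:
  assumes "p \<le> 2" and vanish: "\<And>n. blocks p n 1 = 0" and "norm z1 \<le> 1" and "norm z2 \<le> 1"
  shows "norm (\<Sum>k<M. z1 ^ (2 ^ k) * blocks p (2 ^ k) z2 / of_nat (2 ^ k) ^ (p + 1)) \<le> 18432"
proof -
  have p: "(4::real) ^ p \<le> 16"
    using assms(1) power_increasing[of p 2 "4::real"] by simp
  define d where "d = norm (1 - z2)"
  define f where "f k = norm (blocks p (2 ^ k) z2) / (2 ^ k) ^ (p + 1)" for k
  have "norm (\<Sum>k<M. z1 ^ (2 ^ k) * blocks p (2 ^ k) z2 / of_nat (2 ^ k) ^ (p + 1)) \<le> (\<Sum>k<M. f k)"
    using assms(3)
    by (intro sum_norm_le)
      (auto simp: f_def norm_mult norm_divide norm_power power_le_one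
         intro!: divide_right_mono mult_left_le_one_le)
  also have "\<dots> \<le> 6 * 3072"
  proof (rule dyadic_sum_le)
    fix k
    define n :: real where "n = 2 ^ k"
    have n: "n > 0"
      by (simp add: n_def)
    have "norm (blocks p (2 ^ k) z2) \<le> 192 * 4 ^ p * n ^ (p + 2) * d"
      using norm_blocks_near[OF assms(4) vanish, of "2 ^ k"] by (simp add: n_def d_def)
    also have "\<dots> \<le> 192 * 16 * n ^ (p + 2) * d"
      using p n by (intro mult_right_mono mult_left_mono) (auto simp: d_def)
    finally show "f k \<le> 3072 * (2 ^ k * d)"
      using n by (simp add: f_def n_def[symmetric] pos_divide_le_eq algebra_simps power2_eq_square)
    have "d * norm (blocks p (2 ^ k) z2) \<le> 32 * 4 ^ p * n ^ p"
      using norm_blocks_far[OF assms(4), of p "2 ^ k"] by (simp add: n_def d_def)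
    also have "\<dots> \<le> 3072 * n ^ p"
      using p n by (intro mult_right_mono) auto
    finally show "f k * (2 ^ k * d) \<le> 3072"
      using n by (simp add: f_def n_def[symmetric] pos_divide_le_eq algebra_simps)
  qed (auto simp: d_def)
  finally show ?thesis
    by simp
qed

section \<open>Assembly of the polynomial and its three norms\<close>

theorem theorem2:
  fixes c :: real
  assumes "c > 0"
  shows "\<exists>F. analytic_polynomial F
           \<and> bidisc_norm (euler_op1 (euler_op1 F)) \<le> 1
           \<and> bidisc_norm (euler_op2 (euler_op2 F)) \<le> 1
           \<and> bidisc_norm (euler_op2 (euler_op1 F)) \<ge> c"
proof -
  \<comment> \<open>Each scale will add at least \<open>1 / 18432\<close> to the mixed derivative at
    \<open>(1, 1)\<close>.\<close>
  obtain M :: nat where M: "real M \<ge> 18432 * c"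
    using real_arch_simple by blast
  \<comment> \<open>Indices are triples: scale \<open>k\<close>, block \<open>b\<close>, position
    \<open>j\<close> inside the block.\<close>
  define T :: "(nat \<times> nat \<times> nat) set"
    where "T = (SIGMA k:{..<M}. {..<3} \<times> {..2 * 2 ^ k})"
  define e1 :: "nat \<times> nat \<times> nat \<Rightarrow> nat" where "e1 = (\<lambda>(k, b, j). 2 ^ k)"
  define e2 :: "nat \<times> nat \<times> nat \<Rightarrow> nat" where "e2 = (\<lambda>(k, b, j). j + b * 2 ^ k)"
  define a :: "nat \<times> nat \<times> nat \<Rightarrow> complex"
    where "a = (\<lambda>(k, b, j). of_real (block_weight b) / (18432 * (2 ^ k) ^ 3))"
  define F where "F = (\<lambda>(z1, z2). \<Sum>t\<in>T. a t * z1 ^ e1 t * z2 ^ e2 t)"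
  define G :: "nat \<Rightarrow> nat \<Rightarrow> complex \<times> complex \<Rightarrow> complex"
    where "G q p = (\<lambda>(z1, z2). \<Sum>t\<in>T. (of_nat (e1 t ^ q * e2 t ^ p) * a t) * z1 ^ e1 t * z2 ^ e2 t)"
    for q p
  have "finite T"
    by (auto simp: T_def)
  then have poly: "analytic_polynomial F"
    unfolding F_def by (rule analytic_polynomial_sum)
  have E: "euler_op1 (euler_op1 F) = G 2 0" "euler_op2 (euler_op2 F) = G 0 2"
    "euler_op2 (euler_op1 F) = G 1 1"
    unfolding F_def G_def euler_op1_sum euler_op2_sum
    by (simp_all add: power2_eq_square mult.assoc mult.left_commute)
  \<comment> \<open>One formula covers all three second-order operators: \<open>q\<close>
    derivatives in \<open>z1\<close> give \<open>n ^ q\<close>, and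
    \<open>n ^ q / n ^ 3 = 1 / n ^ (p + 1)\<close>.\<close>
  have G: "G q p (z1, z2) =
      (\<Sum>k<M. z1 ^ (2 ^ k) * blocks p (2 ^ k) z2 / of_nat (2 ^ k) ^ (p + 1)) / 18432"
    if "q + p = 2" for q p z1 z2
  proof -
    have cancel: "(2 ^ k) ^ q / (2 ^ k) ^ 3 = (1 / (2 ^ k) ^ (p + 1) :: complex)" for k :: nat
    proof -
      have "3 = q + (p + 1)"
        using that by simp
      then have "(2 ^ k) ^ 3 = ((2 ^ k) ^ q * (2 ^ k) ^ (p + 1) :: complex)"
        by (simp only: power_add)
      then show ?thesis
        by simp
    qed
    have nested: "(\<Sum>k<M. \<Sum>b<3. \<Sum>j\<le>2 * 2 ^ k. f k b j) = (\<Sum>(k, b, j)\<in>T. f k b j)"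
      for f :: "nat \<Rightarrow> nat \<Rightarrow> nat \<Rightarrow> complex"
      unfolding T_def by (simp add: sum.cartesian_product sum.Sigma)
    have "G q p (z1, z2) = (\<Sum>k<M. \<Sum>b<3. \<Sum>j\<le>2 * 2 ^ k. ((2 ^ k) ^ q / (2 ^ k) ^ 3) *
        (z1 ^ (2 ^ k) * (of_real (block_weight b) *
          (of_nat ((j + b * 2 ^ k) ^ p) * z2 ^ (j + b * 2 ^ k)))) / 18432)"
      unfolding G_def prod.case nested
      by (rule sum.cong) (auto simp: e1_def e2_def a_def mult_ac)
    also have "\<dots> = (\<Sum>k<M. z1 ^ (2 ^ k) * blocks p (2 ^ k) z2 / of_nat (2 ^ k) ^ (p + 1)) / 18432"
      unfolding cancel blocks_def
      by (simp add: sum_distrib_left sum_divide_distrib)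
    finally show ?thesis .
  qed
  have "bidisc_norm (G 2 0) \<le> 1"
  proof (rule bidisc_norm_le)
    show "norm (G 2 0 (z1, z2)) \<le> 1" if "norm z1 \<le> 1" "norm z2 \<le> 1" for z1 z2
      using norm_sum_blocks_le[OF _ blocks_0_one that, of M] by (simp add: G norm_divide)
  qed
  moreover have "bidisc_norm (G 0 2) \<le> 1"
  proof (rule bidisc_norm_le)
    show "norm (G 0 2 (z1, z2)) \<le> 1" if "norm z1 \<le> 1" "norm z2 \<le> 1" for z1 z2
      using norm_sum_blocks_le[OF _ blocks_2_one that, of M] by (simp add: G norm_divide)
  qed
  moreover have "c \<le> bidisc_norm (G 1 1)"
  proof -
    have "continuous_on (cball 0 1 \<times> cball 0 1) (G 1 1)"
      unfolding G_def split_beta by (intro continuous_intros)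
    then have le: "norm (G 1 1 (1, 1)) \<le> bidisc_norm (G 1 1)"
      by (rule norm_at_one_le_bidisc_norm)
    \<comment> \<open>All scales contribute with the same sign, so nothing cancels and the sum grows
      linearly in \<open>M\<close>.\<close>
    have scale: "blocks (Suc 0) (2 ^ k) 1 / (2 ^ k * 2 ^ k) = - (4 + 2 / 2 ^ k)" for k
      unfolding blocks_1_one[unfolded One_nat_def] by (simp add: divide_simps)
    have "G 1 1 (1, 1) = of_real (- (\<Sum>k<M. 4 + 2 / 2 ^ k) / 18432)"
      by (simp add: G scale flip: sum_negf)
    then have "norm (G 1 1 (1, 1)) = (\<Sum>k<M. 4 + 2 / 2 ^ k) / 18432"
      by (simp only: norm_of_real) (simp add: sum_nonneg)
    moreover have "(\<Sum>k<M. 4 + 2 / 2 ^ k :: real) \<ge> (\<Sum>k<M. 1)"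
      by (intro sum_mono) (simp add: add_increasing2)
    ultimately show ?thesis
      using le M by simp
  qed
  ultimately show ?thesis
    using poly E by metis
qed

end
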